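(* Let $T,Y_0,Y_1$ be $\{0,1\}$-valued random variables (treatment and potential outcomes) and let $X$ be a random variable (features), and assume unconfoundedness: $Y_t\perp T\mid X$ for $t=0,1$. Put $S_t(x)=P(Y_t=1\mid X=x)$ for $t=0,1$, and $\alpha=P(Y_0=0,Y_1=0)$, $\beta=P(Y_0=1,Y_1=0)$, $\gamma=P(Y_0=0,Y_1=1)$, $\delta=P(Y_0=1,Y_1=1)$. Let $\phi(x)=P(Y_0=0,Y_1=0\mid X=x)-P(Y_0=0\mid X=x)P(Y_1=0\mid X=x)$ and $\phi=\mathbb{E}[\phi(X)]$. Let $\widehat S_0(x),\widehat S_1(x)\in[0,1]$ be estimators of $S_0(x),S_1(x)$ that are functions of $x$ and of a random training set with distribution $D$, and that are unbiased: $\mathbb{E}_D[\widehat S_t(x)]=S_t(x)$ for all $x$ and $t=0,1$. Let $x^{(1)},x^{(2)},\dots$ be an i.i.d. sequence of evaluation points with the distribution of $X$, independent of the training set, and define $$\hat\alpha=\frac1N\sum_{i=1}^N(1-\widehat S_0(x^{(i)}))(1-\widehat S_1(x^{(i)})),\qquad \hat\beta=\frac1N\sum_{i=1}^N\widehat S_0(x^{(i)})(1-\widehat S_1(x^{(i)})),$$ $$\hat\gamma=\frac1N\sum_{i=1}^N(1-\widehat S_0(x^{(i)}))\widehat S_1(x^{(i)}),\qquad \hat\delta=\frac1N\sum_{i=1}^N\widehat S_0(x^{(i)})\widehat S_1(x^{(i)}).$$ Then in the large sample limit $N\to\infty$ the biases satisfy $$\mathrm{Bias}[\hat\beta]=\mathrm{Bias}[\hat\gamma]=-\mathrm{Bias}[\hat\alpha]=-\mathrm{Bias}[\hat\delta]$$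 $$=\alpha\delta-\beta\gamma-\mathrm{cov}_X(S_0(X),S_1(X))-\mathbb{E}_X[\mathrm{cov}_D(\widehat S_0(X),\widehat S_1(X))]$$ $$=\phi-\mathbb{E}_X[\mathrm{cov}_D(\widehat S_0(X),\widehat S_1(X))].$$
   Context: $\mathbb{E}_D$ and $\mathrm{cov}_D$ denote expectation and covariance over the random training set, with the evaluation points (or the argument $x$) held fixed; $\mathbb{E}_X$ and $\mathrm{cov}_X$ are over the distribution of $X$; so $\mathbb{E}_X[\mathrm{cov}_D(\widehat S_0(X),\widehat S_1(X))]$ is the $X$-average of the function $x\mapsto\mathrm{cov}_D(\widehat S_0(x),\widehat S_1(x))$. The bias in the large sample limit of, e.g., $\hat\beta$ means $\mathrm{Bias}[\hat\beta]=\lim_{N\to\infty}\mathbb{E}_D[\hat\beta]-\beta$, the limit holding almost surely with respect to the sequence of evaluation points (and similarly $\lim_{N\to\infty}\mathbb{E}_D[\hat\alpha]-\alpha$, etc.). *)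

theory Defs
  imports "HOL-Probability.Probability"
begin

(* real_cond_exp with respect to the sigma-algebra generated by X gives P(E | X) as a function on
   the sample space.  A function p of x is written P(E | X = x) when it is a version of it, i.e.
   when it is measurable and p(X) = P(E | X) almost surely. *)

definition cond_prob_sigma ::
  "'w measure \<Rightarrow> 'x measure \<Rightarrow> ('w \<Rightarrow> 'x) \<Rightarrow> 'w set \<Rightarrow> 'w \<Rightarrow> real" where
  "cond_prob_sigma M MX X E =
     real_cond_exp M (vimage_algebra (space M) X MX) (indicator E)"

definition is_cond_prob_at ::
  "'w measure \<Rightarrow> 'x measure \<Rightarrow> ('w \<Rightarrow> 'x) \<Rightarrow> 'w set \<Rightarrow> ('x \<Rightarrow> real) \<Rightarrow> bool" where
  "is_cond_prob_at M MX X E p \<longleftrightarrow>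
     p \<in> borel_measurable MX \<and> (AE w in M. p (X w) = cond_prob_sigma M MX X E w)"

definition cond_indep_var ::
  "'w measure \<Rightarrow> 'a measure \<Rightarrow> ('w \<Rightarrow> 'a) \<Rightarrow> 'b measure \<Rightarrow> ('w \<Rightarrow> 'b)
     \<Rightarrow> 'x measure \<Rightarrow> ('w \<Rightarrow> 'x) \<Rightarrow> bool" where
  "cond_indep_var M NA A NB B MX X \<longleftrightarrow>
     A \<in> measurable M NA \<and> B \<in> measurable M NB \<and> X \<in> measurable M MX \<and>
     (\<forall>a\<in>sets NA. \<forall>b\<in>sets NB. AE w in M.
        cond_prob_sigma M MX X {v \<in> space M. A v \<in> a \<and> B v \<in> b} w =
        cond_prob_sigma M MX X {v \<in> space M. A v \<in> a} w *
        cond_prob_sigma M MX X {v \<in> space M. B v \<in> b} w)"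

definition covariance :: "'a measure \<Rightarrow> ('a \<Rightarrow> real) \<Rightarrow> ('a \<Rightarrow> real) \<Rightarrow> real" where
  "covariance M f g =
     (\<integral>x. (f x - (\<integral>y. f y \<partial>M)) * (g x - (\<integral>y. g y \<partial>M)) \<partial>M)"

(* In the estimators, F0 and F1 take a feature value and a training set, pts is the sequence of
   evaluation points (pts i is the point numbered i + 1), N the number of points used and z the
   training set. *)

definition alpha_hat ::
  "('x \<Rightarrow> 'z \<Rightarrow> real) \<Rightarrow> ('x \<Rightarrow> 'z \<Rightarrow> real) \<Rightarrow> (nat \<Rightarrow> 'x) \<Rightarrow> nat \<Rightarrow> 'z \<Rightarrow> real" where
  "alpha_hat F0 F1 pts N z = 1 / real N * (\<Sum>i<N. (1 - F0 (pts i) z) * (1 - F1 (pts i) z))"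

definition beta_hat ::
  "('x \<Rightarrow> 'z \<Rightarrow> real) \<Rightarrow> ('x \<Rightarrow> 'z \<Rightarrow> real) \<Rightarrow> (nat \<Rightarrow> 'x) \<Rightarrow> nat \<Rightarrow> 'z \<Rightarrow> real" where
  "beta_hat F0 F1 pts N z = 1 / real N * (\<Sum>i<N. F0 (pts i) z * (1 - F1 (pts i) z))"

definition gamma_hat ::
  "('x \<Rightarrow> 'z \<Rightarrow> real) \<Rightarrow> ('x \<Rightarrow> 'z \<Rightarrow> real) \<Rightarrow> (nat \<Rightarrow> 'x) \<Rightarrow> nat \<Rightarrow> 'z \<Rightarrow> real" where
  "gamma_hat F0 F1 pts N z = 1 / real N * (\<Sum>i<N. (1 - F0 (pts i) z) * F1 (pts i) z)"

definition delta_hat ::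
  "('x \<Rightarrow> 'z \<Rightarrow> real) \<Rightarrow> ('x \<Rightarrow> 'z \<Rightarrow> real) \<Rightarrow> (nat \<Rightarrow> 'x) \<Rightarrow> nat \<Rightarrow> 'z \<Rightarrow> real" where
  "delta_hat F0 F1 pts N z = 1 / real N * (\<Sum>i<N. F0 (pts i) z * F1 (pts i) z)"

(* Expectation over the training set with the evaluation points fixed inside est.  The limit is
   only meaningful together with convergence, which has to be asserted separately. *)

definition mean_seq :: "'z measure \<Rightarrow> (nat \<Rightarrow> 'z \<Rightarrow> real) \<Rightarrow> nat \<Rightarrow> real" where
  "mean_seq D est N = (\<integral>z. est N z \<partial>D)"

definition bias :: "'z measure \<Rightarrow> (nat \<Rightarrow> 'z \<Rightarrow> real) \<Rightarrow> real \<Rightarrow> real" where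
  "bias D est \<theta> = lim (mean_seq D est) - \<theta>"

end

theory Submission
  imports Defs
begin

text \<open>
  With the evaluation points fixed, the expectation of each estimator over the training set is an
  average of i.i.d. bounded variables, so by the strong law of large numbers (Hoeffding's inequality
  and Borel--Cantelli) it converges almost surely to its \<open>X\<close>-expectation. Unbiasedness and the tower
  property reduce all four limits to \<open>H = E\<^sub>X[E\<^sub>D[F0 F1]]\<close> and the marginals
  \<open>P(Y0 = 1) = \<beta> + \<delta>\<close>, \<open>P(Y1 = 1) = \<gamma> + \<delta>\<close>; the biases are then \<open>\<plusminus>(\<delta> - H)\<close>.
\<close>

text \<open>Hoeffding bounds the probability of a deviation of at least \<open>e\<close>
  geometrically in \<open>n\<close>, so almost surely only finitely many such deviations occur.
  \<open>W\<close> is a separate representative of the common law: below it becomes a function of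
  \<open>X\<close>, while the \<open>V i\<close> come from the points \<open>xs i\<close>.\<close>

lemma (in prob_space) strong_law_bounded_iid:
  fixes V :: "nat \<Rightarrow> 'a \<Rightarrow> real"
  assumes indep: "indep_vars (\<lambda>_. borel) V UNIV"
    and distr: "\<And>i. distr M borel (V i) = distr M borel W"
    and W [measurable]: "random_variable borel W"
    and bounded: "AE w in M. W w \<in> {a..b}"
  shows "AE w in M. (\<lambda>n. (\<Sum>i<n. V i w) / real n) \<longlonglongrightarrow> expectation W"
proof -
  \<comment> \<open>If \<open>a = b\<close>, the exponent in Hoeffding's bound would have
    denominator 0. Raising the upper end keeps the bound on \<open>W\<close> and makes the length of
    the interval positive.\<close>
  define c where "c = max b (a + 1)"
  have ac: "a < c" by (simp add: c_def)
  have V [measurable]: "\<And>i. random_variable borel (V i)"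
    using indep by (auto simp: indep_vars_def)
  have near: "AE w in M. \<forall>\<^sub>F n in sequentially. \<bar>(\<Sum>i<n. V i w) / real n - expectation W\<bar> < e"
    if e: "e > 0" for e :: real
  proof -
    \<comment> \<open>The ratio of the geometric series that dominates: Hoeffding's bound for
      \<open>n\<close> variables is \<open>2 * r ^ n\<close>.\<close>
    define r where "r = exp (- 2 * e\<^sup>2 / (c - a)\<^sup>2)"
    define B where "B n = {w \<in> space M. \<bar>(\<Sum>i<n. V i w) / real n - expectation W\<bar> \<ge> e}" for n
    have B [measurable]: "B n \<in> events" for n
      unfolding B_def by measurable
    have r: "0 < r" "r < 1"
      using ac e by (auto simp: r_def)
    have "prob (B n) \<le> 2 * r ^ n" if "n > 0" for n
    proof -
      interpret H: Hoeffding_ineq_iid M "{..<n}" V W a c "expectation W"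
      proof unfold_locales
        show "indep_vars (\<lambda>_. borel) V {..<n}"
          using indep by (rule indep_vars_subset) simp
        show "AE w in M. W w \<in> {a..c}"
          using bounded by eventually_elim (auto simp: c_def)
      qed (auto simp: distr)
      have "prob (B n) \<le> 2 * exp (- 2 * real n * e\<^sup>2 / (c - a)\<^sup>2)"
        using H.Hoeffding_ineq_abs_ge'[of e] e ac that by (simp add: B_def lessThan_empty_iff)
      also have "exp (- 2 * real n * e\<^sup>2 / (c - a)\<^sup>2) = r ^ n"
        by (simp add: r_def flip: exp_of_nat_mult)
      finally show ?thesis .
    qed
    \<comment> \<open>The bound covers \<open>n > 0\<close>, where the average runs over a nonempty
      family; summability depends only on the tail.\<close>
    then have "\<forall>\<^sub>F n in sequentially. norm (prob (B n)) \<le> 2 * r ^ n"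
      by (intro eventually_mono[OF eventually_gt_at_top[of 0]]) simp
    moreover have "summable (\<lambda>n. 2 * r ^ n)"
      using r by (intro summable_mult summable_geometric) simp
    ultimately have "summable (\<lambda>n. prob (B n))"
      by (rule summable_comparison_test_ev)
    then have "AE w in M. \<forall>\<^sub>F n in sequentially. w \<in> space M - B n"
      by (intro borel_cantelli_AE1) (auto simp: emeasure_eq_measure)
    then show ?thesis
      by eventually_elim (auto elim!: eventually_mono simp: B_def)
  qed
  \<comment> \<open>The exceptional null set depends on the tolerance. Countably many tolerances
    \<open>inverse (Suc k)\<close> yield a single null set and still get below every positive
    \<open>e\<close>.\<close>
  have "AE w in M. \<forall>k. \<forall>\<^sub>F n in sequentially.
          \<bar>(\<Sum>i<n. V i w) / real n - expectation W\<bar> < inverse (real (Suc k))"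
    by (subst AE_all_countable) (intro allI near, simp)
  then show ?thesis
  proof eventually_elim
    case (elim w)
    show ?case
    proof (rule tendstoI)
      fix e :: real assume "e > 0"
      then obtain k where "inverse (real (Suc k)) < e"
        using reals_Archimedean by blast
      with elim show "\<forall>\<^sub>F n in sequentially. dist ((\<Sum>i<n. V i w) / real n) (expectation W) < e"
        by (auto elim!: eventually_mono[OF spec[of _ k]] simp: dist_real_def)
    qed
  qed
qed

text \<open>With the points fixed, linearity moves the integral over \<open>D\<close> inside the
  sum, leaving averages of one bounded function \<open>g\<close> at i.i.d. points, to which the
  strong law applies. The general \<open>G\<close> serves all four estimators.\<close>

lemma (in prob_space) mean_seq_average_tendsto:
  fixes G :: "'x \<Rightarrow> 'z \<Rightarrow> real"
  assumes D: "prob_space D"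
    and X [measurable]: "X \<in> measurable M MX"
    and indep: "indep_vars (\<lambda>_. MX) xs UNIV"
    and distr: "\<And>i. distr M MX (xs i) = distr M MX X"
    and G: "(\<lambda>(x, z). G x z) \<in> borel_measurable (MX \<Otimes>\<^sub>M D)"
    and range: "\<And>x z. x \<in> space MX \<Longrightarrow> z \<in> space D \<Longrightarrow> G x z \<in> {0..1}"
  shows "AE w in M. mean_seq D (\<lambda>N z. 1 / real N * (\<Sum>i<N. G (xs i w) z))
           \<longlonglongrightarrow> (\<integral>x. (\<integral>z. G x z \<partial>D) \<partial>(distr M MX X))"
proof -
  interpret D: prob_space D by fact
  define g where "g x = (\<integral>z. G x z \<partial>D)" for x
  have g [measurable]: "g \<in> borel_measurable MX"
    unfolding g_def using D.borel_measurable_lebesgue_integral[OF G] by simp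
  have xs [measurable]: "xs i \<in> measurable M MX" for i
    using indep by (auto simp: indep_vars_def)
  have int: "integrable D (G x)" if "x \<in> space MX" for x
    using range[OF that] measurable_Pair2[OF G that]
    by (intro D.integrable_const_bound[where B = 1]) auto
  have g01: "g x \<in> {0..1}" if "x \<in> space MX" for x
    using int[OF that] range[OF that] D.integral_ge_const[of "G x" 0] D.integral_le_const[of "G x" 1]
    by (auto simp: g_def)
  have "AE w in M. (\<lambda>n. (\<Sum>i<n. g (xs i w)) / real n) \<longlonglongrightarrow> expectation (\<lambda>w. g (X w))"
  proof (rule strong_law_bounded_iid)
    show "indep_vars (\<lambda>_. borel) (\<lambda>i w. g (xs i w)) UNIV"
      using indep by (rule indep_vars_compose2) simp
    show "distr M borel (\<lambda>w. g (xs i w)) = distr M borel (\<lambda>w. g (X w))" for i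
      using distr_distr[OF g xs, of i] distr_distr[OF g X] distr[of i] by (simp add: comp_def)
    show "AE w in M. g (X w) \<in> {0..1}"
      using g01 measurable_space[OF X] by auto
  qed simp
  \<comment> \<open>This holds for every \<open>N\<close>: for \<open>N = 0\<close> the sums are
    empty and both sides are 0.\<close>
  moreover have "mean_seq D (\<lambda>N z. 1 / real N * (\<Sum>i<N. G (xs i w) z)) =
      (\<lambda>n. (\<Sum>i<n. g (xs i w)) / real n)" if "w \<in> space M" for w
    using int measurable_space[OF xs that]
    by (simp add: fun_eq_iff mean_seq_def g_def)
  moreover have "expectation (\<lambda>w. g (X w)) = (\<integral>x. g x \<partial>(distr M MX X))"
    by (simp add: integral_distr)
  ultimately show ?thesis
    by (auto simp: g_def)
qed

lemma (in prob_space) covariance_eq: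
  assumes "integrable M f" "integrable M g" "integrable M (\<lambda>x. f x * g x :: real)"
  shows "covariance M f g = expectation (\<lambda>x. f x * g x) - expectation f * expectation g"
proof -
  have "(\<lambda>x. (f x - expectation f) * (g x - expectation g)) =
    (\<lambda>x. f x * g x - expectation g * f x - expectation f * g x + expectation f * expectation g)"
    by (simp add: fun_eq_iff algebra_simps)
  then show ?thesis
    using assms by (simp add: covariance_def prob_space)
qed

text \<open>Makes the rules for \<open>real_cond_exp\<close> available on the sigma-algebra
  generated by \<open>X\<close>.\<close>

lemma (in prob_space) finite_measure_subalgebra_vimage_algebra:
  assumes "X \<in> measurable M MX"
  shows "finite_measure_subalgebra M (vimage_algebra (space M) X MX)"
proof unfold_locales
  show "subalgebra M (vimage_algebra (space M) X MX)"
    using assms measurable_sets[OF assms] measurable_space[OF assms]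
    by (auto simp: subalgebra_def sets_vimage_algebra2)
qed

text \<open>The tower property for the indicator of \<open>E\<close>, carried over to an arbitrary
  version \<open>p\<close> by almost sure equality.\<close>

lemma (in prob_space) is_cond_prob_at_expectation:
  assumes X: "X \<in> measurable M MX" and E: "E \<in> events" and p: "is_cond_prob_at M MX X E p"
  shows "integrable M (\<lambda>w. p (X w))" and "expectation (\<lambda>w. p (X w)) = prob E"
proof -
  interpret finite_measure_subalgebra M "vimage_algebra (space M) X MX"
    by (rule finite_measure_subalgebra_vimage_algebra[OF X])
  have ind: "integrable M (indicator E :: _ \<Rightarrow> real)"
    using E by (simp add: integrable_real_indicator less_top[symmetric])
  have pX: "(\<lambda>w. p (X w)) \<in> borel_measurable M"
    and ae: "AE w in M. p (X w) = cond_prob_sigma M MX X E w"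
    using p X by (auto simp: is_cond_prob_at_def)
  have c: "integrable M (cond_prob_sigma M MX X E)"
    "expectation (cond_prob_sigma M MX X E) = prob E"
    using real_cond_exp_int[OF ind] E by (auto simp: cond_prob_sigma_def)
  show "integrable M (\<lambda>w. p (X w))"
    using c(1) pX ae by (subst integrable_cong_AE[OF _ _ ae]) auto
  show "expectation (\<lambda>w. p (X w)) = prob E"
    using c pX ae by (subst integral_cong_AE[OF _ _ ae]) auto
qed

text \<open>Linearity of conditional expectation. The relation is only almost sure because
  \<open>p\<close> and \<open>q\<close> are arbitrary versions; it will link \<open>q0\<close>,
  \<open>q1\<close> to \<open>S0\<close>, \<open>S1\<close>.\<close>

lemma (in prob_space) is_cond_prob_at_compl:
  assumes X: "X \<in> measurable M MX" and E: "E \<in> events"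
    and p: "is_cond_prob_at M MX X E p" and q: "is_cond_prob_at M MX X (space M - E) q"
  shows "AE w in M. q (X w) = 1 - p (X w)"
proof -
  interpret finite_measure_subalgebra M "vimage_algebra (space M) X MX"
    by (rule finite_measure_subalgebra_vimage_algebra[OF X])
  have ind: "integrable M (indicator E :: _ \<Rightarrow> real)"
    using E by (simp add: integrable_real_indicator less_top[symmetric])
  \<comment> \<open>The two integrands agree on \<open>space M\<close> but differ outside it, which
    an almost everywhere congruence ignores.\<close>
  have "AE w in M. real_cond_exp M (vimage_algebra (space M) X MX) (indicator (space M - E)) w =
     real_cond_exp M (vimage_algebra (space M) X MX) (\<lambda>w. 1 - indicator E w) w"
    using E by (intro real_cond_exp_cong) (auto simp: indicator_def)
  moreover have "AE w in M. real_cond_exp M (vimage_algebra (space M) X MX) (\<lambda>w. 1 - indicator E w) w =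
     real_cond_exp M (vimage_algebra (space M) X MX) (\<lambda>w. 1) w -
     real_cond_exp M (vimage_algebra (space M) X MX) (indicator E) w"
    using ind by (intro real_cond_exp_diff) auto
  moreover have "AE w in M. real_cond_exp M (vimage_algebra (space M) X MX) (\<lambda>w. 1) w = 1"
    by (intro real_cond_exp_F_meas) auto
  moreover have "AE w in M. p (X w) = cond_prob_sigma M MX X E w"
    "AE w in M. q (X w) = cond_prob_sigma M MX X (space M - E) w"
    using p q by (auto simp: is_cond_prob_at_def)
  ultimately show ?thesis
    unfolding cond_prob_sigma_def by eventually_elim simp
qed

theorem theorem2:
  fixes M :: "'w measure" and MX :: "'x measure" and D :: "'z measure"
    and T Y0 Y1 :: "'w \<Rightarrow> nat" and X :: "'w \<Rightarrow> 'x"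
    and S0 S1 p00 q0 q1 \<phi>fun :: "'x \<Rightarrow> real"
    and \<alpha> \<beta> \<gamma> \<delta> \<phi> :: real
    and F0 F1 :: "'x \<Rightarrow> 'z \<Rightarrow> real"
    and Z :: "'w \<Rightarrow> 'z" and xs :: "nat \<Rightarrow> 'w \<Rightarrow> 'x"
  assumes prob: "prob_space M"
    and T: "T \<in> measurable M (count_space {0, 1})"
    and Y0: "Y0 \<in> measurable M (count_space {0, 1})"
    and Y1: "Y1 \<in> measurable M (count_space {0, 1})"
    and X: "X \<in> measurable M MX"
    and unconf0: "cond_indep_var M (count_space {0, 1}) Y0 (count_space {0, 1}) T MX X"
    and unconf1: "cond_indep_var M (count_space {0, 1}) Y1 (count_space {0, 1}) T MX X"
    and S0: "is_cond_prob_at M MX X {w \<in> space M. Y0 w = 1} S0"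
    and S1: "is_cond_prob_at M MX X {w \<in> space M. Y1 w = 1} S1"
    and alpha: "\<alpha> = \<P>(w in M. Y0 w = 0 \<and> Y1 w = 0)"
    and beta: "\<beta> = \<P>(w in M. Y0 w = 1 \<and> Y1 w = 0)"
    and gamma: "\<gamma> = \<P>(w in M. Y0 w = 0 \<and> Y1 w = 1)"
    and delta: "\<delta> = \<P>(w in M. Y0 w = 1 \<and> Y1 w = 1)"
    and p00: "is_cond_prob_at M MX X {w \<in> space M. Y0 w = 0 \<and> Y1 w = 0} p00"
    and q0: "is_cond_prob_at M MX X {w \<in> space M. Y0 w = 0} q0"
    and q1: "is_cond_prob_at M MX X {w \<in> space M. Y1 w = 0} q1"
    and phi_fun: "\<And>x. x \<in> space MX \<Longrightarrow> \<phi>fun x = p00 x - q0 x * q1 x"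
    and phi: "\<phi> = (\<integral>w. \<phi>fun (X w) \<partial>M)"
    and Z: "Z \<in> measurable M D" "distr M D Z = D"
    and F0_meas: "(\<lambda>(x, z). F0 x z) \<in> borel_measurable (MX \<Otimes>\<^sub>M D)"
    and F1_meas: "(\<lambda>(x, z). F1 x z) \<in> borel_measurable (MX \<Otimes>\<^sub>M D)"
    and F0_range: "\<And>x z. x \<in> space MX \<Longrightarrow> z \<in> space D \<Longrightarrow> F0 x z \<in> {0..1}"
    and F1_range: "\<And>x z. x \<in> space MX \<Longrightarrow> z \<in> space D \<Longrightarrow> F1 x z \<in> {0..1}"
    and F0_unbiased: "\<And>x. x \<in> space MX \<Longrightarrow> (\<integral>z. F0 x z \<partial>D) = S0 x"
    and F1_unbiased: "\<And>x. x \<in> space MX \<Longrightarrow> (\<integral>z. F1 x z \<partial>D) = S1 x"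
    and xs_indep: "prob_space.indep_vars M (\<lambda>_. MX) xs UNIV"
    and xs_distr: "\<And>i. distr M MX (xs i) = distr M MX X"
    and xs_Z_indep:
      "prob_space.indep_set M
        (sets (vimage_algebra (space M) (\<lambda>w i. xs i w) (Pi\<^sub>M UNIV (\<lambda>_. MX))))
        (sets (vimage_algebra (space M) Z D))"
  shows "AE w in M.
    (let pts = (\<lambda>i. xs i w);
         a = alpha_hat F0 F1 pts; b = beta_hat F0 F1 pts;
         c = gamma_hat F0 F1 pts; d = delta_hat F0 F1 pts;
         E_cov_D = (\<integral>x. covariance D (F0 x) (F1 x) \<partial>(distr M MX X))
     in convergent (mean_seq D a) \<and> convergent (mean_seq D b) \<and>
        convergent (mean_seq D c) \<and> convergent (mean_seq D d) \<and>
        bias D b \<beta> = bias D c \<gamma> \<and>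
        bias D c \<gamma> = - bias D a \<alpha> \<and>
        - bias D a \<alpha> = - bias D d \<delta> \<and>
        - bias D d \<delta> = \<alpha> * \<delta> - \<beta> * \<gamma> - covariance (distr M MX X) S0 S1 - E_cov_D \<and>
        \<alpha> * \<delta> - \<beta> * \<gamma> - covariance (distr M MX X) S0 S1 - E_cov_D = \<phi> - E_cov_D)"
proof -
  interpret prob_space M by (fact prob)
  \<comment> \<open>\<open>D\<close> is a probability measure because it is the law of the training
    set \<open>Z\<close>.\<close>
  interpret D: prob_space D
    using prob_space_distr[OF Z(1)] Z(2) by simp
  let ?P = "distr M MX X"
  interpret P: prob_space ?P
    by (rule prob_space_distr[OF X])
  note [measurable] = X Y0 Y1 F0_meas[unfolded case_prod_beta'] F1_meas[unfolded case_prod_beta']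
  have S_meas [measurable]: "S0 \<in> borel_measurable MX" "S1 \<in> borel_measurable MX"
    using S0 S1 by (auto simp: is_cond_prob_at_def)
  have Y01: "Y0 w = 0 \<or> Y0 w = 1" "Y1 w = 0 \<or> Y1 w = 1" if "w \<in> space M" for w
    using measurable_space[OF Y0 that] measurable_space[OF Y1 that] by auto
  \<comment> \<open>\<open>j\<close> is any natural number, so \<open>{j}\<close> is cut down to
    \<open>{0, 1}\<close> to become a set of the count space.\<close>
  have sg [measurable]: "{w \<in> space M. Y0 w = j} \<in> events" "{w \<in> space M. Y1 w = j} \<in> events" for j
  proof -
    have "{w \<in> space M. Y0 w = j} = Y0 -` ({j} \<inter> {0, 1}) \<inter> space M"
      "{w \<in> space M. Y1 w = j} = Y1 -` ({j} \<inter> {0, 1}) \<inter> space M"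
      using Y01 by auto
    then show "{w \<in> space M. Y0 w = j} \<in> events" "{w \<in> space M. Y1 w = j} \<in> events"
      by (simp_all only:) (intro measurable_sets[OF Y0] measurable_sets[OF Y1]; simp)+
  qed
  have ev: "{w \<in> space M. Y0 w = j \<and> Y1 w = k} \<in> events" for j k
  proof -
    have "{w \<in> space M. Y0 w = j \<and> Y1 w = k} =
        {w \<in> space M. Y0 w = j} \<inter> {w \<in> space M. Y1 w = k}"
      by auto
    then show ?thesis
      using sets.Int[OF sg(1)[of j] sg(2)[of k]] by (simp only:)
  qed

  \<comment> \<open>First and mixed moments of the estimators\<close>
  define \<Phi> where "\<Phi> x = (\<integral>z. F0 x z * F1 x z \<partial>D)" for x
  \<comment> \<open>Expanding any of the four products leaves only 1, \<open>F0\<close>,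
    \<open>F1\<close> and \<open>F0 * F1\<close>, whose averages are 1, \<open>m0\<close>,
    \<open>m1\<close> and \<open>H\<close>. All four limits are therefore affine in these
    numbers.\<close>
  define H where "H = (\<integral>x. \<Phi> x \<partial>?P)"
  define m0 where "m0 = (\<integral>x. S0 x \<partial>?P)"
  define m1 where "m1 = (\<integral>x. S1 x \<partial>?P)"

  have F_meas: "F0 x \<in> borel_measurable D" "F1 x \<in> borel_measurable D" if "x \<in> space MX" for x
    using measurable_Pair2[OF F0_meas that] measurable_Pair2[OF F1_meas that] by auto
  have prod01: "u * v \<in> {0..1}" if "u \<in> {0..1}" "v \<in> {0..1}" for u v :: real
    using that by (auto intro: mult_le_one)
  have F_int: "integrable D (F0 x)" "integrable D (F1 x)" "integrable D (\<lambda>z. F0 x z * F1 x z)"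
    if "x \<in> space MX" for x
    using F_meas[OF that] F0_range[OF that] F1_range[OF that] prod01[OF F0_range[OF that] F1_range[OF that]]
    by (auto intro!: D.integrable_const_bound[where B = 1])
  have mean01: "(\<integral>z. f z \<partial>D) \<in> {0..1}"
    if "integrable D f" "\<And>z. z \<in> space D \<Longrightarrow> f z \<in> {0..1}" for f :: "'z \<Rightarrow> real"
    using that D.integral_ge_const[of f 0] D.integral_le_const[of f 1] by auto
  \<comment> \<open>A version of a conditional probability lies in the unit interval only almost
    surely. Here unbiasedness gives the bound at every point, as \<open>S0 x\<close> and
    \<open>S1 x\<close> are means of values in that interval.\<close>
  have S01: "S0 x \<in> {0..1}" "S1 x \<in> {0..1}" "\<Phi> x \<in> {0..1}" if "x \<in> space MX" for x
    using mean01[OF F_int(1)[OF that] F0_range[OF that]] mean01[OF F_int(2)[OF that] F1_range[OF that]]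
      mean01[OF F_int(3)[OF that] prod01[OF F0_range[OF that] F1_range[OF that]]]
      F0_unbiased[OF that] F1_unbiased[OF that]
    by (simp_all add: \<Phi>_def)
  have \<Phi>_meas [measurable]: "\<Phi> \<in> borel_measurable MX"
    unfolding \<Phi>_def by measurable
  have P_int [simp]: "integrable ?P S0" "integrable ?P S1" "integrable ?P \<Phi>"
    "integrable ?P (\<lambda>x. S0 x * S1 x)"
    using S01 prod01[OF S01(1,2)] by (auto intro!: P.integrable_const_bound[where B = 1])

  \<comment> \<open>Marginals and total mass of the joint law of the outcomes\<close>
  have m: "m0 = \<beta> + \<delta>" "m1 = \<gamma> + \<delta>" "\<alpha> + \<beta> + \<gamma> + \<delta> = 1"
  proof -
    have "m0 = prob {w \<in> space M. Y0 w = 1}" "m1 = prob {w \<in> space M. Y1 w = 1}"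
      using is_cond_prob_at_expectation(2)[OF X _ S0] is_cond_prob_at_expectation(2)[OF X _ S1]
      by (simp_all add: m0_def m1_def integral_distr)
    \<comment> \<open>The split is kept general in \<open>j\<close>: the value 1 gives both
      marginals, and the values 0 and 1 together give the total mass.\<close>
    moreover have "{w \<in> space M. Y0 w = j} =
        {w \<in> space M. Y0 w = j \<and> Y1 w = 0} \<union> {w \<in> space M. Y0 w = j \<and> Y1 w = 1}"
      "{w \<in> space M. Y1 w = j} =
        {w \<in> space M. Y0 w = 0 \<and> Y1 w = j} \<union> {w \<in> space M. Y0 w = 1 \<and> Y1 w = j}" for j
      using Y01 by auto
    then have split: "prob {w \<in> space M. Y0 w = j} =
        prob {w \<in> space M. Y0 w = j \<and> Y1 w = 0} + prob {w \<in> space M. Y0 w = j \<and> Y1 w = 1}"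
      "prob {w \<in> space M. Y1 w = j} =
        prob {w \<in> space M. Y0 w = 0 \<and> Y1 w = j} + prob {w \<in> space M. Y0 w = 1 \<and> Y1 w = j}" for j
      by (simp_all only:) (subst finite_measure_Union; use ev in auto)+
    ultimately show "m0 = \<beta> + \<delta>" "m1 = \<gamma> + \<delta>"
      using split[of 1] by (simp_all add: beta gamma delta)
    have "{w \<in> space M. Y0 w = 0} \<union> {w \<in> space M. Y0 w = 1} = space M"
      using Y01 by auto
    moreover have "{w \<in> space M. Y0 w = 0} \<inter> {w \<in> space M. Y0 w = 1} = {}"
      by auto
    ultimately have "prob {w \<in> space M. Y0 w = 0} + prob {w \<in> space M. Y0 w = 1} = 1"
      using sg finite_measure_Union[of "{w \<in> space M. Y0 w = 0}" "{w \<in> space M. Y0 w = 1}"] prob_space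
      by auto
    then show "\<alpha> + \<beta> + \<gamma> + \<delta> = 1"
      using split(1)[of 0] split(1)[of 1] by (simp add: alpha beta gamma delta)
  qed

  \<comment> \<open>Covariances and \<open>\<phi>\<close> in terms of moments\<close>
  have cov_S: "covariance ?P S0 S1 = (\<integral>x. S0 x * S1 x \<partial>?P) - m0 * m1"
    by (simp add: P.covariance_eq m0_def m1_def)
  \<comment> \<open>By unbiasedness the product of the \<open>D\<close>-means is
    \<open>S0 x * S1 x\<close>. Added to \<open>cov_S\<close>, this is the law of total covariance:
    the two terms sum to \<open>H - m0 * m1\<close>.\<close>
  have E_cov: "(\<integral>x. covariance D (F0 x) (F1 x) \<partial>?P) = H - (\<integral>x. S0 x * S1 x \<partial>?P)"
  proof -
    have "(\<integral>x. covariance D (F0 x) (F1 x) \<partial>?P) = (\<integral>x. \<Phi> x - S0 x * S1 x \<partial>?P)"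
      by (intro Bochner_Integration.integral_cong)
        (auto simp: D.covariance_eq F_int F0_unbiased F1_unbiased \<Phi>_def)
    then show ?thesis by (simp add: H_def)
  qed
  have \<phi>_eq: "\<phi> = \<alpha> - 1 + m0 + m1 - (\<integral>x. S0 x * S1 x \<partial>?P)"
  proof -
    have c: "{w \<in> space M. Y0 w = 0} = space M - {w \<in> space M. Y0 w = 1}"
      "{w \<in> space M. Y1 w = 0} = space M - {w \<in> space M. Y1 w = 1}"
      using Y01 by force+
    \<comment> \<open>\<open>q0\<close> and \<open>q1\<close> belong to the complements of the
      events behind \<open>S0\<close> and \<open>S1\<close>, so the product in
      \<open>\<phi>fun\<close> can be expanded in \<open>S0\<close> and \<open>S1\<close>.\<close>
    have "AE w in M. q0 (X w) = 1 - S0 (X w)" "AE w in M. q1 (X w) = 1 - S1 (X w)"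
      using is_cond_prob_at_compl[OF X _ S0] is_cond_prob_at_compl[OF X _ S1] q0 q1
      by (auto simp: c)
    then have ae: "AE w in M. \<phi>fun (X w) = p00 (X w) - (1 - S0 (X w)) * (1 - S1 (X w))"
      using phi_fun measurable_space[OF X] by (auto elim!: AE_mp)
    have [measurable]: "p00 \<in> borel_measurable MX" "q0 \<in> borel_measurable MX" "q1 \<in> borel_measurable MX"
      using p00 q0 q1 by (auto simp: is_cond_prob_at_def)
    have "(\<lambda>w. p00 (X w) - q0 (X w) * q1 (X w)) \<in> borel_measurable M"
      by measurable
    \<comment> \<open>\<open>\<phi>fun\<close> is prescribed only on \<open>space MX\<close>, so
      measurability is established for its composition with \<open>X\<close>.\<close>
    moreover have "(\<lambda>w. \<phi>fun (X w)) \<in> borel_measurable M \<longleftrightarrow>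
        (\<lambda>w. p00 (X w) - q0 (X w) * q1 (X w)) \<in> borel_measurable M"
      using phi_fun measurable_space[OF X] by (intro measurable_cong) simp
    ultimately have [measurable]: "(\<lambda>w. \<phi>fun (X w)) \<in> borel_measurable M"
      by simp
    have int: "integrable M (\<lambda>w. S0 (X w))" "integrable M (\<lambda>w. S1 (X w))"
      "integrable M (\<lambda>w. S0 (X w) * S1 (X w))"
      using P_int by (auto intro: integrable_distr[OF X])
    have p: "integrable M (\<lambda>w. p00 (X w))" "expectation (\<lambda>w. p00 (X w)) = \<alpha>"
      using is_cond_prob_at_expectation[OF X ev p00] by (auto simp: alpha)
    have "\<phi> = (\<integral>w. p00 (X w) - (1 - S0 (X w)) * (1 - S1 (X w)) \<partial>M)"
      unfolding phi using ae by (intro integral_cong_AE) measurable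
    also have "\<dots> = (\<integral>w. p00 (X w) - 1 + S0 (X w) + S1 (X w) - S0 (X w) * S1 (X w) \<partial>M)"
      by (simp add: algebra_simps)
    finally show ?thesis
      using int p by (simp add: m0_def m1_def integral_distr prob_space)
  qed

  \<comment> \<open>Almost sure limits of the four mean sequences\<close>
  have lim_a: "AE w in M. mean_seq D (alpha_hat F0 F1 (\<lambda>i. xs i w)) \<longlonglongrightarrow> 1 - m0 - m1 + H"
  proof -
    \<comment> \<open>Unbiasedness is read from right to left: once \<open>S0 x\<close> and
      \<open>S1 x\<close> are written as \<open>D\<close>-means, the identity at each
      \<open>x\<close> is linearity over \<open>D\<close>.\<close>
    have "(\<integral>x. (\<integral>z. (1 - F0 x z) * (1 - F1 x z) \<partial>D) \<partial>?P) = (\<integral>x. 1 - S0 x - S1 x + \<Phi> x \<partial>?P)"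
      using F_int by (intro Bochner_Integration.integral_cong)
        (auto simp: \<Phi>_def algebra_simps D.prob_space simp flip: F0_unbiased F1_unbiased)
    also have "\<dots> = 1 - m0 - m1 + H"
      using P.prob_space by (simp add: m0_def m1_def H_def)
    finally show ?thesis
      using mean_seq_average_tendsto[OF D.prob_space_axioms X xs_indep xs_distr,
          where G = "\<lambda>x z. (1 - F0 x z) * (1 - F1 x z)"] F0_range F1_range
      by (simp add: alpha_hat_def[abs_def] mult_le_one)
  qed
  have lim_b: "AE w in M. mean_seq D (beta_hat F0 F1 (\<lambda>i. xs i w)) \<longlonglongrightarrow> m0 - H"
  proof -
    have "(\<integral>x. (\<integral>z. F0 x z * (1 - F1 x z) \<partial>D) \<partial>?P) = (\<integral>x. S0 x - \<Phi> x \<partial>?P)"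
      using F_int by (intro Bochner_Integration.integral_cong)
        (auto simp: \<Phi>_def algebra_simps D.prob_space simp flip: F0_unbiased F1_unbiased)
    also have "\<dots> = m0 - H"
      by (simp add: m0_def H_def)
    finally show ?thesis
      using mean_seq_average_tendsto[OF D.prob_space_axioms X xs_indep xs_distr,
          where G = "\<lambda>x z. F0 x z * (1 - F1 x z)"] F0_range F1_range
      by (simp add: beta_hat_def[abs_def] mult_le_one)
  qed
  have lim_c: "AE w in M. mean_seq D (gamma_hat F0 F1 (\<lambda>i. xs i w)) \<longlonglongrightarrow> m1 - H"
  proof -
    have "(\<integral>x. (\<integral>z. (1 - F0 x z) * F1 x z \<partial>D) \<partial>?P) = (\<integral>x. S1 x - \<Phi> x \<partial>?P)"
      using F_int by (intro Bochner_Integration.integral_cong)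
        (auto simp: \<Phi>_def algebra_simps D.prob_space simp flip: F0_unbiased F1_unbiased)
    also have "\<dots> = m1 - H"
      by (simp add: m1_def H_def)
    finally show ?thesis
      using mean_seq_average_tendsto[OF D.prob_space_axioms X xs_indep xs_distr,
          where G = "\<lambda>x z. (1 - F0 x z) * F1 x z"] F0_range F1_range
      by (simp add: gamma_hat_def[abs_def] mult_le_one)
  qed
  \<comment> \<open>The \<open>D\<close>-mean of this product is \<open>\<Phi>\<close> by
    definition, so the limit is \<open>H\<close> directly.\<close>
  have lim_d: "AE w in M. mean_seq D (delta_hat F0 F1 (\<lambda>i. xs i w)) \<longlonglongrightarrow> H"
    using mean_seq_average_tendsto[OF D.prob_space_axioms X xs_indep xs_distr,
        where G = "\<lambda>x z. F0 x z * F1 x z"] F0_range F1_range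
    by (simp add: delta_hat_def[abs_def] mult_le_one H_def \<Phi>_def)

  \<comment> \<open>Algebra of the biases\<close>
  have key: "\<alpha> * \<delta> - \<beta> * \<gamma> + m0 * m1 = \<delta>"
  proof -
    \<comment> \<open>Since the total mass is 1, this expresses
      \<open>\<alpha> * \<delta> - \<beta> * \<gamma>\<close> as \<open>\<delta> - m0 * m1\<close>,
      the covariance of the two binary outcomes.\<close>
    have "\<alpha> * \<delta> - \<beta> * \<gamma> + m0 * m1 = (\<alpha> + \<beta> + \<gamma> + \<delta>) * \<delta>"
      unfolding m(1,2) by algebra
    then show ?thesis by (simp add: m(3))
  qed
  show ?thesis
    using lim_a lim_b lim_c lim_d
  proof eventually_elim
    case (elim w)
    note lims = elim[THEN limI]
    \<comment> \<open>The integral of \<open>S0 * S1\<close> cancels from both closing formulas. The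
      first reduces to \<open>\<delta> - H\<close> by \<open>key\<close>, the one with
      \<open>\<phi>\<close> by the marginals and the total mass; the biases for
      \<open>\<beta>\<close> and \<open>\<gamma>\<close> equal \<open>\<delta> - H\<close>, the
      other two its negative.\<close>
    show ?case
      unfolding Let_def bias_def lims cov_S E_cov \<phi>_eq
      using elim key m by (auto simp: convergent_def)
  qed
qed

end
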